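(* Let $p\in[1,+\infty]$ and let $k\geq1$ be an integer. Let $V:=\{v_1^{(k)},\ldots,v_{2^k}^{(k)}\}$, and let $f\colon(V,\|\cdot\|_p)\to(\ell_1,\|\cdot\|_1)$ be the map $v_\ell^{(k)}\mapsto v_\ell^{(k)}$. If $F\colon(V\cup\{0\},\|\cdot\|_p)\to(\ell_1,\|\cdot\|_1)$ is a Lipschitz extension of $f$, then $$\operatorname{Lip}(F)\geq\left(2-\frac{1}{2^{k-1}}\right)^{\frac{1}{p_\star}}\operatorname{Lip}(f),$$ where $1/p_\star:=1-1/p$ if $p\neq+\infty$ and $1/p_\star:=1$ if $p=+\infty$.
   Context: The Walsh matrices $W_k$ ($k\ge 0$), of size $2^k\times 2^k$, are defined recursively by $$W_0:=(1),\qquad W_{k+1}:=\begin{pmatrix} W_k & W_k \\ W_k & -W_k \end{pmatrix}.$$ For $k\geq1$, $W_k'$ is the $(2^k-1)\times2^k$ matrix obtained from $W_k$ by deleting its first row, and $v_\ell^{(k)}\in\mathbb{R}^{2^k-1}$ is the $\ell$-th column of $W_k'$, for $\ell\in\{1,\ldots,2^k\}$. Vectors in $\mathbb{R}^{2^k-1}$ are regarded as elements of $\ell_q$ for every $q\in[1,+\infty]$ via the canonical embedding (padding by zeros). A set of vectors written with $\|\cdot\|_p$ carries the metric $\|x-y\|_p$. For a map $g$ from a metric space $(A,d_A)$ to a metric space $(B,d_B)$, $\operatorname{Lip}(g):=\inf\{L\geq0: d_B(g(x),g(x'))\leq L\,d_A(x,x')\ \forall x,x'\in A\}$. *)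

theory Defs
  imports "HOL-Library.Extended_Real" "HOL-Library.FuncSet" "Jordan_Normal_Form.Matrix"
begin

fun walsh :: "nat \<Rightarrow> real mat" where
  "walsh 0 = 1\<^sub>m 1"
| "walsh (Suc k) = four_block_mat (walsh k) (walsh k) (walsh k) (- walsh k)"

definition delete_first_row :: "'a mat \<Rightarrow> 'a mat" where
  "delete_first_row A = mat (dim_row A - 1) (dim_col A) (\<lambda>(i, j). A $$ (Suc i, j))"

definition zero_pad :: "real vec \<Rightarrow> nat \<Rightarrow> real" where
  "zero_pad v = (\<lambda>i. if i < dim_vec v then v $ i else 0)"

text \<open>Columns are numbered from 0, so \<open>walsh_column k l\<close>, for \<open>l < 2 ^ k\<close>, is the
  vector usually written $v^{(k)}_{l+1}$, already embedded into the sequence spaces.\<close>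

definition walsh_column :: "nat \<Rightarrow> nat \<Rightarrow> nat \<Rightarrow> real" where
  "walsh_column k l = zero_pad (col (delete_first_row (walsh k)) l)"

definition walsh_columns :: "nat \<Rightarrow> (nat \<Rightarrow> real) set" where
  "walsh_columns k = walsh_column k ` {..<2 ^ k}"

text \<open>The exponent \<open>q\<close> below is meant to satisfy \<open>1 \<le> q \<le> \<infinity>\<close>, and \<open>lq_norm q\<close> is meant to be
  applied to elements of \<open>lq_space q\<close> only.\<close>

definition lq_space :: "ereal \<Rightarrow> (nat \<Rightarrow> real) set" where
  "lq_space q =
    (if q = \<infinity> then {x. bdd_above (range (\<lambda>i. \<bar>x i\<bar>))}
     else {x. summable (\<lambda>i. \<bar>x i\<bar> powr real_of_ereal q)})"

definition lq_norm :: "ereal \<Rightarrow> (nat \<Rightarrow> real) \<Rightarrow> real" where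
  "lq_norm q x =
    (if q = \<infinity> then (SUP i. \<bar>x i\<bar>)
     else (\<Sum>i. \<bar>x i\<bar> powr real_of_ereal q) powr (1 / real_of_ereal q))"

definition lq_dist :: "ereal \<Rightarrow> (nat \<Rightarrow> real) \<Rightarrow> (nat \<Rightarrow> real) \<Rightarrow> real" where
  "lq_dist q x y = lq_norm q (\<lambda>i. x i - y i)"

definition lipschitz_bounds ::
    "'a set \<Rightarrow> ('a \<Rightarrow> 'a \<Rightarrow> real) \<Rightarrow> ('b \<Rightarrow> 'b \<Rightarrow> real) \<Rightarrow> ('a \<Rightarrow> 'b) \<Rightarrow> real set" where
  "lipschitz_bounds A dA dB g =
    {L. 0 \<le> L \<and> (\<forall>x\<in>A. \<forall>y\<in>A. dB (g x) (g y) \<le> L * dA x y)}"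

definition is_lipschitz ::
    "'a set \<Rightarrow> ('a \<Rightarrow> 'a \<Rightarrow> real) \<Rightarrow> ('b \<Rightarrow> 'b \<Rightarrow> real) \<Rightarrow> ('a \<Rightarrow> 'b) \<Rightarrow> bool" where
  "is_lipschitz A dA dB g \<longleftrightarrow> lipschitz_bounds A dA dB g \<noteq> {}"

text \<open>The infimum is taken in the reals, so \<open>Lip\<close> is meaningful for Lipschitz maps only; it is
  unspecified, rather than \<open>\<infinity>\<close>, for other maps.\<close>

definition Lip ::
    "'a set \<Rightarrow> ('a \<Rightarrow> 'a \<Rightarrow> real) \<Rightarrow> ('b \<Rightarrow> 'b \<Rightarrow> real) \<Rightarrow> ('a \<Rightarrow> 'b) \<Rightarrow> real" where
  "Lip A dA dB g = Inf (lipschitz_bounds A dA dB g)"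

text \<open>The reciprocal $1/p_\star$ of the conjugate exponent.\<close>

definition inv_conj_exponent :: "ereal \<Rightarrow> real" where
  "inv_conj_exponent p = (if p = \<infinity> then 1 else 1 - 1 / real_of_ereal p)"

end

theory Submission imports Defs begin

text \<open>Put \<open>N = 2 ^ k\<close> and let \<open>c\<close> be the reciprocal conjugate exponent. All entries of \<open>walsh k\<close>
  are \<open>1\<close> or \<open>-1\<close>, its columns are pairwise orthogonal and it is symmetric.

  Two distinct columns therefore differ in exactly half of their \<open>N\<close> entries, and never in the
  first one, so deleting the first row loses nothing: their difference takes only
  the absolute values \<open>0\<close> and \<open>2\<close> and has \<open>\<ell>\<^sub>1\<close>-norm \<open>N\<close>. A vector with absolute values in \<open>{0, a}\<close>
  and \<open>\<ell>\<^sub>1\<close>-norm \<open>s\<close> has \<open>\<ell>\<^sub>p\<close>-norm \<open>a powr c * s powr (1 - c)\<close> (lemma \<open>lq_norm_two_valued\<close>).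
  Hence the inclusion of the columns into \<open>\<ell>\<^sub>1\<close> has Lipschitz constant at most
  \<open>(N / 2) powr c\<close>.

  On the other hand, the image \<open>z\<close> of \<open>0\<close> cannot be close to all columns at once. Every row but
  the first is orthogonal to the all-ones first row, so in every coordinate the entries
  \<open>1\<close> and \<open>-1\<close> occur equally often, and no choice of a coordinate of \<open>z\<close> beats the value \<open>0\<close> on
  average. So the average \<open>\<ell>\<^sub>1\<close>-distance from \<open>z\<close> to the columns is at least \<open>N - 1\<close>, whereas
  each column has \<open>\<ell>\<^sub>p\<close>-norm \<open>(N - 1) powr (1 - c)\<close>. This forces a Lipschitz
  constant of at least \<open>(N - 1) powr c\<close>, and the quotient of the two bounds is
  \<open>(2 - 2 / N) powr c\<close>.\<close>

section \<open>Entries of Walsh matrices\<close>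

lemma walsh_carrier: "walsh k \<in> carrier_mat (2 ^ k) (2 ^ k)"
proof (induction k)
  case 0
  show ?case by simp
next
  case (Suc k)
  have "four_block_mat (walsh k) (walsh k) (walsh k) (- walsh k)
      \<in> carrier_mat (2 ^ k + 2 ^ k) (2 ^ k + 2 ^ k)"
    by (rule four_block_carrier_mat) (use Suc in auto)
  then show ?case by (simp add: mult_2)
qed

lemma walsh_dim [simp]: "dim_row (walsh k) = 2 ^ k" "dim_col (walsh k) = 2 ^ k"
  using walsh_carrier[of k] by auto

lemma walsh_Suc_index:
  assumes "i < 2 ^ k" "j < 2 ^ k"
  shows "walsh (Suc k) $$ (i, j) = walsh k $$ (i, j)"
    and "walsh (Suc k) $$ (i, j + 2 ^ k) = walsh k $$ (i, j)"
    and "walsh (Suc k) $$ (i + 2 ^ k, j) = walsh k $$ (i, j)"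
    and "walsh (Suc k) $$ (i + 2 ^ k, j + 2 ^ k) = - walsh k $$ (i, j)"
  using assms by auto

lemma less_two_power_Suc_cases:
  fixes i :: nat
  assumes "i < 2 ^ Suc k"
  obtains "i < 2 ^ k" | i' where "i' < 2 ^ k" "i = i' + 2 ^ k"
proof (cases "i < 2 ^ k")
  case False
  with assms that(2)[of "i - 2 ^ k"] show ?thesis by simp
qed (use that in blast)

lemma walsh_entry:
  assumes "i < 2 ^ k" "j < 2 ^ k"
  shows "walsh k $$ (i, j) \<in> {1, -1}"
  using assms
proof (induction k arbitrary: i j)
  case 0
  then show ?case by simp
next
  case (Suc k)
  note IH = Suc.IH
  show ?case
    by (rule less_two_power_Suc_cases[OF Suc.prems(1)];
        rule less_two_power_Suc_cases[OF Suc.prems(2)])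
      (use IH in \<open>auto simp: walsh_Suc_index simp del: walsh.simps\<close>)
qed

lemma walsh_sym:
  assumes "i < 2 ^ k" "j < 2 ^ k"
  shows "walsh k $$ (i, j) = walsh k $$ (j, i)"
  using assms
proof (induction k arbitrary: i j)
  case 0
  then show ?case by simp
next
  case (Suc k)
  note IH = Suc.IH
  show ?case
    by (rule less_two_power_Suc_cases[OF Suc.prems(1)];
        rule less_two_power_Suc_cases[OF Suc.prems(2)])
      (use IH in \<open>auto simp: walsh_Suc_index simp del: walsh.simps\<close>)
qed

lemma walsh_first_row: "j < 2 ^ k \<Longrightarrow> walsh k $$ (0, j) = 1"
proof (induction k arbitrary: j)
  case 0
  then show ?case by simp
next
  case (Suc k)
  note IH = Suc.IH
  show ?case
    by (rule less_two_power_Suc_cases[OF Suc.prems])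
      (use IH in \<open>auto simp: walsh_Suc_index simp del: walsh.simps\<close>)
qed

lemma sum_lessThan_two_power_Suc:
  "(\<Sum>i<2 ^ Suc k. g i) = (\<Sum>i<2 ^ k. g i) + (\<Sum>i<2 ^ k. g (i + 2 ^ k))"
  for g :: "nat \<Rightarrow> 'a :: comm_monoid_add"
proof -
  have "(\<Sum>i<2 ^ k + 2 ^ k. g i) = (\<Sum>i<2 ^ k. g i) + (\<Sum>i=2 ^ k..<2 ^ k + 2 ^ k. g i)"
    by (simp add: lessThan_atLeast0 sum.atLeastLessThan_concat)
  also have "(\<Sum>i=2 ^ k..<2 ^ k + 2 ^ k. g i) = (\<Sum>i<2 ^ k. g (i + 2 ^ k))"
    using sum.shift_bounds_nat_ivl[of g 0 "2 ^ k" "2 ^ k"] by (simp add: lessThan_atLeast0)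
  finally show ?thesis by (simp add: mult_2)
qed

text \<open>In the recursive step the upper and the lower half of the scalar product of two columns are
  equal up to sign; they cancel when one column lies in the left and the other in the right half of
  the matrix, the only case in which two distinct columns can come from the same smaller one.\<close>

lemma walsh_columns_orthogonal:
  assumes "l < 2 ^ k" "m < 2 ^ k"
  shows "(\<Sum>i<2 ^ k. walsh k $$ (i, l) * walsh k $$ (i, m)) = (if l = m then 2 ^ k else 0)"
  using assms
proof (induction k arbitrary: l m)
  case 0
  then show ?case by simp
next
  case (Suc k)
  note IH = Suc.IH
  show ?case
    unfolding sum_lessThan_two_power_Suc
    by (rule less_two_power_Suc_cases[OF Suc.prems(1)];
        rule less_two_power_Suc_cases[OF Suc.prems(2)])
      (use IH in \<open>auto simp: walsh_Suc_index sum_negf simp del: walsh.simps\<close>)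
qed

lemma walsh_row_sum:
  assumes "0 < i" "i < 2 ^ k"
  shows "(\<Sum>l<2 ^ k. walsh k $$ (i, l)) = 0"
proof -
  have "(\<Sum>l<2 ^ k. walsh k $$ (i, l)) = (\<Sum>l<2 ^ k. walsh k $$ (l, 0) * walsh k $$ (l, i))"
    using assms by (intro sum.cong) (auto simp: walsh_sym[of _ k 0] walsh_sym[of i] walsh_first_row)
  with assms show ?thesis by (simp add: walsh_columns_orthogonal)
qed

section \<open>Norms of vectors with two absolute values\<close>

lemma lq_norm_zero [simp]: "lq_norm q (\<lambda>i. 0) = 0"
  by (simp add: lq_norm_def)

lemma lq_norm_one:
  assumes "x \<in> lq_space 1"
  shows "summable (\<lambda>i. \<bar>x i\<bar>)" "lq_norm 1 x = (\<Sum>i. \<bar>x i\<bar>)"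
proof -
  show "summable (\<lambda>i. \<bar>x i\<bar>)" using assms by (simp add: lq_space_def)
  then have "0 \<le> (\<Sum>i. \<bar>x i\<bar>)" by (simp add: suminf_nonneg)
  then show "lq_norm 1 x = (\<Sum>i. \<bar>x i\<bar>)" by (simp add: lq_norm_def)
qed

text \<open>For finite \<open>p\<close> the reason is the identity \<open>\<bar>x i\<bar> powr p = a powr (p - 1) * \<bar>x i\<bar>\<close>. Expressing
  the norm through the reciprocal conjugate exponent makes the formula cover \<open>p = \<infinity>\<close> too, where
  it reads \<open>a\<close>; there \<open>0 < s\<close> guarantees that the value \<open>a\<close> is attained.\<close>

lemma lq_norm_two_valued:
  fixes p :: ereal and x :: "nat \<Rightarrow> real"
  assumes p: "1 \<le> p"
    and two: "\<And>i. \<bar>x i\<bar> \<in> {0, a}" and "0 < a"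
    and supp: "\<And>i. n \<le> i \<Longrightarrow> x i = 0"
    and s: "(\<Sum>i<n. \<bar>x i\<bar>) = s" and "0 < s"
  shows "lq_norm p x = a powr inv_conj_exponent p * s powr (1 - inv_conj_exponent p)"
proof (cases "p = \<infinity>")
  case True
  have "\<exists>i. x i \<noteq> 0"
  proof (rule ccontr)
    assume "\<not> ?thesis"
    with s \<open>0 < s\<close> show False by simp
  qed
  then obtain j where "\<bar>x j\<bar> = a" using two by (metis abs_eq_0 empty_iff insert_iff)
  have le: "\<bar>x i\<bar> \<le> a" for i using two[of i] \<open>0 < a\<close> by auto
  have "(SUP i. \<bar>x i\<bar>) = a"
  proof (rule cSup_eq_maximum)
    show "a \<in> range (\<lambda>i. \<bar>x i\<bar>)" using \<open>\<bar>x j\<bar> = a\<close> by (metis rangeI)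
  qed (use le in auto)
  with True \<open>0 < a\<close> \<open>0 < s\<close> show ?thesis
    by (simp add: lq_norm_def inv_conj_exponent_def)
next
  case False
  with p obtain r where r: "p = ereal r" "1 \<le> r" by (cases p) auto
  have "\<bar>x i\<bar> powr r = a powr (r - 1) * \<bar>x i\<bar>" for i
    using two[of i] \<open>0 < a\<close> by (auto simp: powr_diff)
  then have "(\<Sum>i. \<bar>x i\<bar> powr r) = (\<Sum>i<n. a powr (r - 1) * \<bar>x i\<bar>)"
    using suminf_finite[of "{..<n}" "\<lambda>i. \<bar>x i\<bar> powr r"] supp by force
  also have "\<dots> = a powr (r - 1) * s" by (simp add: s sum_distrib_left[symmetric])
  finally have "lq_norm p x = (a powr (r - 1) * s) powr (1 / r)"
    using r by (simp add: lq_norm_def)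
  also have "\<dots> = a powr ((r - 1) * (1 / r)) * s powr (1 / r)"
    using \<open>0 < a\<close> \<open>0 < s\<close> by (simp add: powr_mult powr_powr)
  also have "(r - 1) * (1 / r) = 1 - 1 / r" using r by (simp add: field_simps)
  finally show ?thesis using r by (simp add: inv_conj_exponent_def)
qed

section \<open>Norms and distances of the truncated columns\<close>

lemma walsh_column_eq:
  assumes "l < 2 ^ k"
  shows "walsh_column k l = (\<lambda>i. if i < 2 ^ k - 1 then walsh k $$ (Suc i, l) else 0)"
  using assms by (auto simp: walsh_column_def zero_pad_def delete_first_row_def)

lemma Suc_less_if_less_diff_one: "i < n - 1 \<Longrightarrow> Suc i < n" for n :: nat
  by linarith

lemma lq_norm_walsh_column:
  assumes "1 \<le> p" "1 \<le> k" "l < 2 ^ k"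
  shows "lq_norm p (walsh_column k l) = (2 ^ k - 1) powr (1 - inv_conj_exponent p)"
proof -
  have abs: "\<bar>walsh_column k l i\<bar> = (if i < 2 ^ k - 1 then 1 else 0)" for i
    using walsh_entry[of "Suc i" k l] Suc_less_if_less_diff_one[of i "2 ^ k"] assms
    by (auto simp: walsh_column_eq)
  have "(1 :: real) < 2 ^ k" using assms by (intro one_less_power) auto
  moreover have "(\<Sum>i<2 ^ k - 1. \<bar>walsh_column k l i\<bar>) = 2 ^ k - (1 :: real)"
    by (simp add: abs of_nat_diff)
  ultimately show ?thesis
    using lq_norm_two_valued[of p "walsh_column k l" 1 "2 ^ k - 1" "2 ^ k - 1"] assms
    by (auto simp: abs) (auto simp: walsh_column_eq)
qed

text \<open>For \<open>u, w \<in> {1, -1}\<close> one has \<open>\<bar>u - w\<bar> = 1 - u * w\<close>, so orthogonality of the columns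
  evaluates their \<open>\<ell>\<^sub>1\<close>-distance.\<close>

lemma lq_dist_walsh_columns:
  assumes "1 \<le> p" "l < 2 ^ k" "m < 2 ^ k" "l \<noteq> m"
  shows "lq_dist p (walsh_column k l) (walsh_column k m)
    = 2 powr inv_conj_exponent p * (2 ^ k) powr (1 - inv_conj_exponent p)"
  unfolding lq_dist_def
proof (rule lq_norm_two_valued[where n = "2 ^ k - 1"])
  fix i
  show "\<bar>walsh_column k l i - walsh_column k m i\<bar> \<in> {0, 2}"
    using walsh_entry[of "Suc i" k l] walsh_entry[of "Suc i" k m]
      Suc_less_if_less_diff_one[of i "2 ^ k"] assms
    by (auto simp: walsh_column_eq)
next
  have abs: "\<bar>walsh k $$ (i, l) - walsh k $$ (i, m)\<bar> = 1 - walsh k $$ (i, l) * walsh k $$ (i, m)"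
    if "i < 2 ^ k" for i
    using walsh_entry[of i k l] walsh_entry[of i k m] assms that by auto
  have "(\<Sum>i<2 ^ k - 1. \<bar>walsh_column k l i - walsh_column k m i\<bar>)
      = (\<Sum>i<2 ^ k - 1. \<bar>walsh k $$ (Suc i, l) - walsh k $$ (Suc i, m)\<bar>)"
    using assms by (intro sum.cong) (auto simp: walsh_column_eq)
  also have "\<dots> = (\<Sum>i<Suc (2 ^ k - 1). \<bar>walsh k $$ (i, l) - walsh k $$ (i, m)\<bar>)"
    \<comment> \<open>the entry in the deleted row vanishes\<close>
    using assms by (subst sum.lessThan_Suc_shift) (simp add: walsh_first_row)
  also have "\<dots> = (\<Sum>i<2 ^ k. 1 - walsh k $$ (i, l) * walsh k $$ (i, m))"
    by (simp add: abs)
  also have "\<dots> = 2 ^ k"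
    using assms by (simp add: sum_subtractf walsh_columns_orthogonal)
  finally show "(\<Sum>i<2 ^ k - 1. \<bar>walsh_column k l i - walsh_column k m i\<bar>) = 2 ^ k" .
qed (use assms in \<open>auto simp: walsh_column_eq\<close>)

section \<open>The Lipschitz constant of the inclusion\<close>

lemma bdd_below_lipschitz_bounds: "bdd_below (lipschitz_bounds A dA dB g)"
  by (rule bdd_belowI[of _ 0]) (simp add: lipschitz_bounds_def)

lemma Lip_le: "L \<in> lipschitz_bounds A dA dB g \<Longrightarrow> Lip A dA dB g \<le> L"
  unfolding Lip_def by (intro cInf_lower bdd_below_lipschitz_bounds)

lemma Lip_walsh_inclusion_le:
  assumes "1 \<le> p" "1 \<le> k"
    and f: "\<And>l. l < 2 ^ k \<Longrightarrow> f (walsh_column k l) = walsh_column k l"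
  shows "Lip (walsh_columns k) (lq_dist p) (lq_dist 1) f \<le> (2 ^ (k - 1)) powr inv_conj_exponent p"
proof (rule Lip_le)
  let ?c = "inv_conj_exponent p"
  have half: "(2 :: real) ^ k = 2 ^ (k - 1) * 2" using assms by (cases k) auto
  have "lq_dist 1 (walsh_column k l) (walsh_column k m)
      \<le> (2 ^ (k - 1)) powr ?c * lq_dist p (walsh_column k l) (walsh_column k m)"
    if lm: "l < 2 ^ k" "m < 2 ^ k" for l m
  proof (cases "l = m")
    case True
    then show ?thesis by (simp add: lq_dist_def)
  next
    case False
    have "lq_dist 1 (walsh_column k l) (walsh_column k m) = 2 ^ k"
      using lm False by (subst lq_dist_walsh_columns) (auto simp: inv_conj_exponent_def)
    moreover have "(2 ^ (k - 1)) powr ?c * lq_dist p (walsh_column k l) (walsh_column k m)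
        = (2 ^ (k - 1) * 2) powr ?c * (2 ^ k) powr (1 - ?c)"
      using lm False assms by (subst lq_dist_walsh_columns) (auto simp: powr_mult)
    moreover have "\<dots> = (2 ^ k) powr 1"
      unfolding half[symmetric] by (subst powr_add[symmetric]) simp
    ultimately show ?thesis by simp
  qed
  with f show "(2 ^ (k - 1)) powr ?c
      \<in> lipschitz_bounds (walsh_columns k) (lq_dist p) (lq_dist 1) f"
    by (auto simp: lipschitz_bounds_def walsh_columns_def)
qed

section \<open>The average distance of a point to the columns\<close>

text \<open>If \<open>e\<close> takes the values \<open>1\<close> and \<open>-1\<close> equally often, then the mean of \<open>\<bar>e l - t\<bar>\<close> over \<open>l\<close> is
  smallest at \<open>t = 0\<close>: multiply \<open>e l - t\<close> by the sign \<open>e l\<close> and sum.\<close>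

lemma card_le_sum_abs_diff_balanced_signs:
  fixes e :: "'a \<Rightarrow> real"
  assumes "\<And>l. l \<in> A \<Longrightarrow> e l \<in> {1, -1}" and "(\<Sum>l\<in>A. e l) = 0"
  shows "real (card A) \<le> (\<Sum>l\<in>A. \<bar>e l - t\<bar>)"
proof -
  have "real (card A) = (\<Sum>l\<in>A. 1 - t * e l)"
    by (simp add: sum_subtractf sum_distrib_left[symmetric] assms(2))
  also have "\<dots> \<le> (\<Sum>l\<in>A. \<bar>e l - t\<bar>)"
  proof (rule sum_mono)
    fix l assume "l \<in> A"
    then show "1 - t * e l \<le> \<bar>e l - t\<bar>" using assms(1)[of l] by auto
  qed
  finally show ?thesis .
qed

lemma sum_dist_walsh_columns_ge:
  assumes z: "z \<in> lq_space 1"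
  shows "2 ^ k * (2 ^ k - 1) \<le> (\<Sum>l<2 ^ k. lq_dist 1 (walsh_column k l) z)"
proof -
  let ?M = "2 ^ k - 1 :: nat"
  have "2 ^ k * (2 ^ k - 1 :: real) = (\<Sum>i<?M. 2 ^ k)" by (simp add: of_nat_diff)
  also have "\<dots> \<le> (\<Sum>i<?M. \<Sum>l<2 ^ k. \<bar>walsh k $$ (Suc i, l) - z i\<bar>)"
  proof (rule sum_mono)
    fix i assume "i \<in> {..<?M}"
    then have "Suc i < 2 ^ k" by auto
    then show "2 ^ k \<le> (\<Sum>l<2 ^ k. \<bar>walsh k $$ (Suc i, l) - z i\<bar>)"
      using card_le_sum_abs_diff_balanced_signs[of "{..<2 ^ k}" "\<lambda>l. walsh k $$ (Suc i, l)" "z i"]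
        walsh_entry[of "Suc i" k] walsh_row_sum[of "Suc i" k] by simp
  qed
  also have "\<dots> = (\<Sum>l<2 ^ k. \<Sum>i<?M. \<bar>walsh k $$ (Suc i, l) - z i\<bar>)" by (rule sum.swap)
  also have "\<dots> \<le> (\<Sum>l<2 ^ k. lq_dist 1 (walsh_column k l) z)"
  proof (rule sum_mono)
    fix l :: nat assume "l \<in> {..<2 ^ k}"
    then have col: "walsh_column k l = (\<lambda>i. if i < ?M then walsh k $$ (Suc i, l) else 0)"
      by (simp add: walsh_column_eq)
    have "summable (\<lambda>i. \<bar>walsh_column k l i - z i\<bar>)"
    proof (rule summable_comparison_test')
      show "summable (\<lambda>i. \<bar>z i\<bar>)" using z by (rule lq_norm_one)
      show "norm \<bar>walsh_column k l i - z i\<bar> \<le> \<bar>z i\<bar>" if "?M \<le> i" for i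
        using that by (simp add: col)
    qed
    then have "(\<lambda>i. walsh_column k l i - z i) \<in> lq_space 1" by (simp add: lq_space_def)
    note * = lq_norm_one[OF this]
    have "(\<Sum>i<?M. \<bar>walsh k $$ (Suc i, l) - z i\<bar>) = (\<Sum>i<?M. \<bar>walsh_column k l i - z i\<bar>)"
      by (simp add: col)
    also have "\<dots> \<le> (\<Sum>i. \<bar>walsh_column k l i - z i\<bar>)"
      by (rule sum_le_suminf) (use *(1) in auto)
    finally show "(\<Sum>i<?M. \<bar>walsh k $$ (Suc i, l) - z i\<bar>) \<le> lq_dist 1 (walsh_column k l) z"
      by (simp add: lq_dist_def *(2))
  qed
  finally show ?thesis .
qed

section \<open>Extending the inclusion to the origin\<close>

theorem proposition4p1:
  fixes p :: ereal and k :: nat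
    and f F :: "(nat \<Rightarrow> real) \<Rightarrow> (nat \<Rightarrow> real)"
  assumes "1 \<le> p" and "1 \<le> k"
    and f: "\<And>l. l < 2 ^ k \<Longrightarrow> f (walsh_column k l) = walsh_column k l"
    and F_maps: "F \<in> walsh_columns k \<union> {\<lambda>i. 0} \<rightarrow> lq_space 1"
    and F_extends: "\<And>x. x \<in> walsh_columns k \<Longrightarrow> F x = f x"
    and F_lipschitz: "is_lipschitz (walsh_columns k \<union> {\<lambda>i. 0}) (lq_dist p) (lq_dist 1) F"
  shows "Lip (walsh_columns k \<union> {\<lambda>i. 0}) (lq_dist p) (lq_dist 1) F
    \<ge> (2 - 1 / 2 ^ (k - 1)) powr inv_conj_exponent p * Lip (walsh_columns k) (lq_dist p) (lq_dist 1) f"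
proof -
  let ?c = "inv_conj_exponent p"
  let ?V0 = "walsh_columns k \<union> {\<lambda>i. 0}"
  have half: "(2 :: real) ^ k = 2 ^ (k - 1) * 2" using \<open>1 \<le> k\<close> by (cases k) auto
  have one_less: "(1 :: real) < 2 ^ k" using \<open>1 \<le> k\<close> by (intro one_less_power) auto
  have F_column: "F (walsh_column k l) = walsh_column k l" if "l < 2 ^ k" for l
    using that F_extends f by (simp add: walsh_columns_def)
  have lower: "(2 ^ k - 1) powr ?c \<le> L"
    if L: "L \<in> lipschitz_bounds ?V0 (lq_dist p) (lq_dist 1) F" for L
  proof -
    have "lq_dist 1 (walsh_column k l) (F (\<lambda>i. 0)) \<le> L * (2 ^ k - 1) powr (1 - ?c)"
      if l: "l < 2 ^ k" for l
    proof -
      have "lq_dist 1 (F (walsh_column k l)) (F (\<lambda>i. 0)) \<le> L * lq_dist p (walsh_column k l) (\<lambda>i. 0)"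
        using L l by (auto simp: lipschitz_bounds_def walsh_columns_def)
      then show ?thesis
        using l assms(1,2) by (simp add: F_column lq_dist_def lq_norm_walsh_column)
    qed
    then have "(\<Sum>l<2 ^ k. lq_dist 1 (walsh_column k l) (F (\<lambda>i. 0)))
        \<le> 2 ^ k * (L * (2 ^ k - 1) powr (1 - ?c))"
      using sum_mono[of "{..<2 ^ k :: nat}" "\<lambda>l. lq_dist 1 (walsh_column k l) (F (\<lambda>i. 0))"
        "\<lambda>l. L * (2 ^ k - 1) powr (1 - ?c)"] by simp
    moreover have "F (\<lambda>i. 0) \<in> lq_space 1" using F_maps by blast
    ultimately have "(2 :: real) ^ k * (2 ^ k - 1) \<le> 2 ^ k * (L * (2 ^ k - 1) powr (1 - ?c))"
      by (blast intro: order_trans[OF sum_dist_walsh_columns_ge])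
    then have "(2 :: real) ^ k - 1 \<le> L * (2 ^ k - 1) powr (1 - ?c)" by simp
    moreover have "(2 :: real) ^ k - 1 = (2 ^ k - 1) powr ?c * (2 ^ k - 1) powr (1 - ?c)"
      using one_less by (subst powr_add[symmetric]) simp
    ultimately have "(2 ^ k - 1) powr ?c * (2 ^ k - 1) powr (1 - ?c) \<le> L * (2 ^ k - 1) powr (1 - ?c)"
      by simp
    moreover have "(0 :: real) < (2 ^ k - 1) powr (1 - ?c)" using one_less by simp
    ultimately show ?thesis by (rule mult_right_le_imp_le)
  qed
  have "(2 - 1 / 2 ^ (k - 1)) powr ?c * Lip (walsh_columns k) (lq_dist p) (lq_dist 1) f
      \<le> (2 - 1 / 2 ^ (k - 1)) powr ?c * (2 ^ (k - 1)) powr ?c"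
    by (intro mult_left_mono Lip_walsh_inclusion_le assms(1,2) f) auto
  also have "\<dots> = ((2 - 1 / 2 ^ (k - 1)) * 2 ^ (k - 1)) powr ?c"
    by (rule powr_mult[symmetric])
  also have "(2 - 1 / 2 ^ (k - 1)) * 2 ^ (k - 1) = (2 ^ k - 1 :: real)"
    by (subst half) (simp add: field_simps)
  also have "(2 ^ k - 1) powr ?c \<le> Lip ?V0 (lq_dist p) (lq_dist 1) F"
    unfolding Lip_def using F_lipschitz lower
    by (intro cInf_greatest) (auto simp: is_lipschitz_def)
  finally show ?thesis .
qed

end
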